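(* Let $G$ be a nontrivial subgroup of $(\mathbb{Q},+)$, let $k\ge 1$, and let $\chi\colon \mathcal{P}_k\to\mathbb{N}\cup\{\infty\}$ be a rank intersection configuration of size $k$. Then $\chi$ is realizable in $G$ if and only if the following conditions hold: (i) $\operatorname{im}(\chi)\subseteq\{0,1,\infty\}$; (ii) $\chi$ is decreasing, i.e. for all $I,J\in\mathcal{P}_k$, $I\subseteq J$ implies $\chi(I)\ge\chi(J)$; (iii) every $0$-minimal subset of $\chi$ is a singleton; (iv) if $G$ has finite support then $|\mathcal{M}_\infty(\chi)|\le|\operatorname{supp}_{-\infty}(G)|$.
   Context: $\mathbb{N}$ contains $0$. $\mathcal{P}_k$ is the set of nonempty subsets of $[k]=\{1,\dots,k\}$, ordered by inclusion. A rank intersection configuration of size $k\ge1$ is a map $\chi\colon\mathcal{P}_k\to\mathbb{N}\cup\{\infty\}$, where the codomain has its natural order. The rank $\operatorname{rk}(H)$ of a group $H$ is the minimum cardinality of a generating set of $H$ (equal to $\infty$ if $H$ is not finitely generated). $\chi$ is realizable in a group $G$ if there exist subgroups $H_1,\dots,H_k\leqslant G$ such that $\operatorname{rk}\left(\bigcap_{i\in I}H_i\right)=\chi(I)$ for every $I\in\mathcal{P}_k$. A subset $I\in\mathcal{P}_k$ is $r$-minimal for $\chi$ if it is an inclusion-minimal element of $\chi^{-1}(r)$, and $r$-maximal if it is an inclusion-maximal element of $\chi^{-1}(r)$; $\mathcal{M}_\infty(\chi)$ is the set of $\infty$-maximal subsets for $\chi$. For a nontrivial subgroup $G\leqslant\mathbb{Q}$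 and a prime $p$, let $\operatorname{lgcd}_p(G)\in\mathbb{Z}\cup\{-\infty\}$ be the infimum of the $p$-adic valuations of the nonzero elements of $G$. $G$ has finite support if $\{p \text{ prime}:\operatorname{lgcd}_p(G)\ne0\}$ is finite, and $\operatorname{supp}_{-\infty}(G)=\{p\text{ prime}:\operatorname{lgcd}_p(G)=-\infty\}$. *)

theory Defs
  imports
    "HOL-Algebra.Generated_Groups"
    "HOL-Computational_Algebra.Primes"
    "HOL-Library.Extended_Real"
begin

text \<open>The infimum of the empty set in \<^typ>\<open>enat\<close> is \<open>\<infinity>\<close>, which is
  the value for groups that are not finitely generated.\<close>

definition group_rank :: "('a, 'b) monoid_scheme \<Rightarrow> enat" where
  "group_rank G = Inf {enat (card S) | S. finite S \<and> S \<subseteq> carrier G \<and> generate G S = carrier G}"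

definition nonempty_subsets :: "nat \<Rightarrow> nat set set" where
  "nonempty_subsets k = Pow {1..k} - {{}}"

text \<open>A rank intersection configuration of size \<open>k\<close> is a function
  \<open>\<chi> :: nat set \<Rightarrow> enat\<close> of which only the values on \<^term>\<open>nonempty_subsets k\<close> matter.\<close>

definition realizable :: "nat \<Rightarrow> (nat set \<Rightarrow> enat) \<Rightarrow> ('a, 'b) monoid_scheme \<Rightarrow> bool" where
  "realizable k \<chi> G \<longleftrightarrow>
     (\<exists>H. (\<forall>i\<in>{1..k}. subgroup (H i) G) \<and>
          (\<forall>I\<in>nonempty_subsets k. group_rank (G\<lparr>carrier := \<Inter>i\<in>I. H i\<rparr>) = \<chi> I))"

definition level_set :: "nat \<Rightarrow> (nat set \<Rightarrow> enat) \<Rightarrow> enat \<Rightarrow> nat set set" where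
  "level_set k \<chi> r = {I \<in> nonempty_subsets k. \<chi> I = r}"

definition minimal_subsets :: "nat \<Rightarrow> (nat set \<Rightarrow> enat) \<Rightarrow> enat \<Rightarrow> nat set set" where
  "minimal_subsets k \<chi> r = {I \<in> level_set k \<chi> r. \<forall>J\<in>level_set k \<chi> r. J \<subseteq> I \<longrightarrow> J = I}"

definition maximal_subsets :: "nat \<Rightarrow> (nat set \<Rightarrow> enat) \<Rightarrow> enat \<Rightarrow> nat set set" where
  "maximal_subsets k \<chi> r = {I \<in> level_set k \<chi> r. \<forall>J\<in>level_set k \<chi> r. I \<subseteq> J \<longrightarrow> J = I}"

definition rat_group :: "rat monoid" where
  "rat_group = \<lparr>carrier = UNIV, monoid.mult = (+), one = 0\<rparr>"

lemma group_rat_group: "group rat_group"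
  unfolding rat_group_def
proof (rule groupI; simp)
  show "\<exists>y. y + x = 0" for x :: rat
    by (rule exI [of _ "- x"]) simp
qed

text \<open>Only meaningful for \<open>x \<noteq> 0\<close> and prime \<open>p\<close>; \<^const>\<open>quotient_of\<close> yields
  coprime numerator and denominator, the latter positive.\<close>

definition padic_val :: "nat \<Rightarrow> rat \<Rightarrow> int" where
  "padic_val p x =
     int (multiplicity (int p) (fst (quotient_of x))) -
     int (multiplicity (int p) (snd (quotient_of x)))"

text \<open>For nontrivial \<open>G\<close> this is an infimum of a nonempty set of integers, so it is
  either an integer (attained) or \<open>-\<infinity>\<close>; \<^typ>\<open>ereal\<close> merely
  provides the complete lattice.\<close>

definition lgcd :: "nat \<Rightarrow> rat set \<Rightarrow> ereal" where
  "lgcd p G = (INF x\<in>G - {0}. ereal (real_of_int (padic_val p x)))"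

definition finite_support :: "rat set \<Rightarrow> bool" where
  "finite_support G \<longleftrightarrow> finite {p. prime p \<and> lgcd p G \<noteq> 0}"

definition supp_minus_inf :: "rat set \<Rightarrow> nat set" where
  "supp_minus_inf G = {p. prime p \<and> lgcd p G = -\<infinity>}"

end

theory Submission
  imports Defs "HOL-Library.Countable_Set" "HOL-Library.Disjoint_Sets"
begin

text \<open>Fix \<open>x \<noteq> 0\<close> in a subgroup \<open>H\<close> of the rationals and consider the set of \<open>b > 0\<close> with
  \<open>x / b \<in> H\<close>, which turns intersections of subgroups containing \<open>x\<close> into intersections. Finitely
  generated subgroups are cyclic, and \<open>H\<close> is cyclic iff this set is finite. It is infinite iff it
  contains infinitely many primes, which means that \<open>H\<close> has infinite support, or all powers of some
  prime, which means that this prime is in \<open>supp_minus_inf H\<close>.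

  Finite intersections of nontrivial subgroups are nontrivial, whence condition (iii). If \<open>G\<close> has
  finite support, each \<open>\<infinity>\<close>-maximal \<open>M\<close> has a prime \<open>p\<close> at which all \<open>H i\<close> with \<open>i \<in> M\<close> are infinitely
  divisible; by maximality \<open>M\<close> consists of all such \<open>i\<close>, so \<open>M\<close> is determined by \<open>p\<close>.

  Conversely, choose for the \<open>\<infinity>\<close>-maximal \<open>M\<close> pairwise disjoint sets of primes \<open>P M\<close>, each of which
  suffices to make denominators unbounded: singletons in \<open>supp_minus_inf G\<close>, or infinite sets if
  the support is infinite. Let \<open>H i\<close> be trivial if \<open>\<chi> {i} = 0\<close>, and otherwise let it consist of
  the elements of \<open>G\<close> whose denominator relative to \<open>x\<close> involves only primes in some \<open>P M\<close> with
  \<open>i \<in> M\<close>. By disjointness a prime survives in the intersection over \<open>I\<close> iff \<open>I \<subseteq> M\<close> for its \<open>M\<close>.\<close>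

section \<open>Subgroups of the rationals\<close>

lemma carrier_rat_group [simp]: "carrier rat_group = UNIV"
  and mult_rat_group [simp]: "x \<otimes>\<^bsub>rat_group\<^esub> y = x + y"
  and one_rat_group [simp]: "\<one>\<^bsub>rat_group\<^esub> = 0"
  by (simp_all add: rat_group_def)

lemma inv_rat_group [simp]: "inv\<^bsub>rat_group\<^esub> x = - x"
  by (rule group.inv_equality [OF group_rat_group]) auto

lemma subgroup_rat_iff: "subgroup H rat_group \<longleftrightarrow> 0 \<in> H \<and> (\<forall>x\<in>H. \<forall>y\<in>H. x - y \<in> H)"
proof
  assume H: "subgroup H rat_group"
  have "x - y \<in> H" if "x \<in> H" "y \<in> H" for x y
    using subgroup.m_closed [OF H that(1) subgroup.m_inv_closed [OF H that(2)]] by simp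
  then show "0 \<in> H \<and> (\<forall>x\<in>H. \<forall>y\<in>H. x - y \<in> H)"
    using subgroup.one_closed [OF H] by simp
next
  assume H: "0 \<in> H \<and> (\<forall>x\<in>H. \<forall>y\<in>H. x - y \<in> H)"
  have neg: "- x \<in> H" if "x \<in> H" for x
    using H that by (metis diff_0)
  have "x + y \<in> H" if "x \<in> H" "y \<in> H" for x y
    using H that neg by (metis diff_minus_eq_add)
  then show "subgroup H rat_group"
    using H neg by unfold_locales auto
qed

lemma subgroup_restrict_iff:
  assumes "subgroup G rat_group"
  shows "subgroup H (rat_group\<lparr>carrier := G\<rparr>) \<longleftrightarrow> subgroup H rat_group \<and> H \<subseteq> G"
  using group.incl_subgroup [OF group_rat_group assms]
    group.subgroup_incl [OF group_rat_group _ assms] subgroup.subset by fastforce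

lemma subgroup_of_int_mult:
  assumes H: "subgroup H rat_group" and x: "x \<in> H"
  shows "of_int n * x \<in> H"
proof -
  have "of_nat m * x \<in> H" for m
  proof (induction m)
    case 0
    then show ?case using H by (simp add: subgroup_rat_iff)
  next
    case (Suc m)
    then show ?case
      using subgroup.m_closed [OF H x Suc] by (simp add: algebra_simps)
  qed
  moreover from this have "- (of_nat m * x) \<in> H" for m
    using H unfolding subgroup_rat_iff by (metis diff_0)
  ultimately show ?thesis
    by (cases n rule: int_cases2) auto
qed

lemma subgroup_INT_rat:
  assumes "\<And>i. i \<in> I \<Longrightarrow> subgroup (H i) rat_group"
  shows "subgroup (\<Inter>i\<in>I. H i) rat_group"
  using assms by (auto simp: subgroup_rat_iff)

text \<open>The generator \<open>c = 0\<close> is allowed, so the trivial subgroup counts as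
  cyclic.\<close>

definition multiples :: "rat \<Rightarrow> rat set" where
  "multiples c = range (\<lambda>n. of_int n * c)"

lemma generate_rat_singleton: "generate rat_group {c} = multiples c"
proof
  have "subgroup (multiples c) rat_group"
    unfolding subgroup_rat_iff multiples_def
    by (auto simp flip: left_diff_distrib of_int_diff intro: range_eqI [of _ _ 0])
  moreover have "c \<in> multiples c"
    unfolding multiples_def by (rule range_eqI [of _ _ 1]) simp
  ultimately show "generate rat_group {c} \<subseteq> multiples c"
    using group.generate_subgroup_incl [OF group_rat_group] by simp
  have "subgroup (generate rat_group {c}) rat_group"
    by (rule group.generate_is_subgroup [OF group_rat_group]) simp
  then show "multiples c \<subseteq> generate rat_group {c}"
    unfolding multiples_def by (auto intro: subgroup_of_int_mult generate.incl)
qed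

text \<open>Multiplication by \<open>r\<close> embeds \<open>H\<close> into the integers, whose
  subgroups are cyclic by division with remainder.\<close>

lemma bounded_denominator_imp_cyclic:
  assumes H: "subgroup H rat_group" and r: "r \<noteq> 0" and int: "\<And>y. y \<in> H \<Longrightarrow> r * y \<in> \<int>"
  shows "\<exists>c. H = multiples c"
proof -
  have elem: "\<exists>n. y = of_int n / r" if "y \<in> H" for y
    using int [OF that] r by (auto elim!: Ints_cases simp: field_simps)
  show ?thesis
  proof (cases "\<exists>n::nat. n > 0 \<and> of_nat n / r \<in> H")
    case False
    have "y = 0" if y: "y \<in> H" for y
    proof -
      obtain n where n: "y = of_int n / r"
        using elem [OF y] by blast
      have neg: "- y \<in> H"
        using H y unfolding subgroup_rat_iff by (metis diff_0)
      have "\<not> n > 0" "\<not> n < 0"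
        using False y neg n by (metis of_int_of_nat_eq zero_less_imp_eq_int,
            metis minus_divide_left neg_0_less_iff_less of_int_minus of_int_of_nat_eq zero_less_imp_eq_int)
      then show ?thesis using n by simp
    qed
    then have "H = multiples 0"
      using H by (auto simp: multiples_def subgroup_rat_iff)
    then show ?thesis ..
  next
    case True
    define d where "d = (LEAST n::nat. n > 0 \<and> of_nat n / r \<in> H)"
    have d: "d > 0" "of_nat d / r \<in> H"
      using LeastI_ex [OF True] by (simp_all add: d_def)
    have least: "d \<le> n" if "n > 0" "of_nat n / r \<in> H" for n
      unfolding d_def using that by (intro Least_le) simp
    have "y \<in> multiples (of_nat d / r)" if y: "y \<in> H" for y
    proof -
      obtain n where n: "y = of_int n / r"
        using elem [OF y] by blast
      \<comment> \<open>Reducing the numerator of \<open>y\<close> modulo \<open>d\<close> stays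
        within \<open>H\<close>, and minimality of \<open>d\<close> forces the remainder to be
        0.\<close>
      have "y - of_int (n div int d) * (of_nat d / r) \<in> H"
        using H y subgroup_of_int_mult [OF H d(2)] by (simp add: subgroup_rat_iff)
      also have "y - of_int (n div int d) * (of_nat d / r)
          = of_int (n - n div int d * int d) / r"
        by (simp add: n diff_divide_distrib)
      also have "n - n div int d * int d = int (nat (n mod int d))"
        using d(1) by (simp add: minus_div_mult_eq_mod)
      finally have "of_nat (nat (n mod int d)) / r \<in> H"
        by (simp only: of_int_of_nat_eq)
      moreover have "nat (n mod int d) < d"
        using d(1) by (simp add: nat_less_iff)
      ultimately have "n mod int d = 0"
        using least [of "nat (n mod int d)"] d(1) pos_mod_sign [of "int d" n] by fastforce
      then obtain m where "n = int d * m" by blast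
      then have "y = of_int m * (of_nat d / r)"
        by (simp add: n)
      then show ?thesis unfolding multiples_def by (rule range_eqI)
    qed
    then have "H = multiples (of_nat d / r)"
      using subgroup_of_int_mult [OF H d(2)] by (auto simp: multiples_def)
    then show ?thesis ..
  qed
qed

text \<open>With \<open>z = a / d\<close> in lowest terms, integrality means
  \<open>d dvd b * a\<close>, and coprimality removes \<open>a\<close>.\<close>

lemma of_int_mult_in_Ints_iff: "of_int b * z \<in> \<int> \<longleftrightarrow> snd (quotient_of z) dvd b" for z :: rat
proof -
  obtain a d where q: "quotient_of z = (a, d)" by fastforce
  have z: "z = of_int a / of_int d" and d: "d > 0" and cop: "coprime a d"
    using quotient_of_div quotient_of_denom_pos quotient_of_coprime q by blast+
  show ?thesis
  proof
    assume "of_int b * z \<in> \<int>"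
    then obtain n where "of_int b * z = of_int n" by (auto elim: Ints_cases)
    then have "of_int (b * a) = (of_int (n * d) :: rat)"
      using d by (simp add: z field_simps)
    then have "b * a = n * d" by (simp only: of_int_eq_iff)
    then have "d dvd b * a" by simp
    then show "snd (quotient_of z) dvd b"
      using cop by (simp add: q coprime_commute coprime_dvd_mult_left_iff)
  next
    assume "snd (quotient_of z) dvd b"
    then obtain m where "b = d * m" by (auto simp: q)
    then have "of_int b * z = of_int (m * a)" using d by (simp add: z)
    then show "of_int b * z \<in> \<int>" by (metis Ints_of_int)
  qed
qed

text \<open>The product \<open>N\<close> of the generators' denominators clears the denominators of
  the whole generated subgroup, because the rationals that \<open>N\<close> makes integral form a
  subgroup.\<close>

lemma finitely_generated_imp_cyclic:
  assumes S: "finite S" and gen: "generate rat_group S = H"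
  shows "\<exists>c. H = multiples c"
proof -
  define N where "N = (\<Prod>z\<in>S. snd (quotient_of z))"
  let ?K = "{y. of_int N * y \<in> \<int>}"
  have "N \<noteq> 0"
    using S quotient_of_denom_pos' by (simp add: N_def) (metis less_irrefl)
  have "S \<subseteq> ?K"
    using S by (auto simp: of_int_mult_in_Ints_iff N_def simp del: of_int_prod)
  moreover have "subgroup ?K rat_group"
    by (simp add: subgroup_rat_iff right_diff_distrib)
  ultimately have "generate rat_group S \<subseteq> ?K"
    by (rule group.generate_subgroup_incl [OF group_rat_group])
  moreover have "subgroup H rat_group"
    using group.generate_is_subgroup [OF group_rat_group, of S] by (simp add: gen)
  ultimately show ?thesis
    using bounded_denominator_imp_cyclic [of H "of_int N"] \<open>N \<noteq> 0\<close> gen by auto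
qed

lemma group_rank_subgroup_rat:
  assumes H: "subgroup H rat_group"
  shows "group_rank (rat_group\<lparr>carrier := H\<rparr>) =
    (if H = {0} then 0 else if \<exists>c. H = multiples c then 1 else \<infinity>)"
proof -
  \<comment> \<open>Generation is taken in the full group \<open>rat_group\<close> here, which
    agrees with generation inside \<open>H\<close>.\<close>
  define A where "A = {enat (card S) | S. finite S \<and> S \<subseteq> H \<and> generate rat_group S = H}"
  have rank: "group_rank (rat_group\<lparr>carrier := H\<rparr>) = Inf A"
    unfolding group_rank_def A_def
    by (rule arg_cong [where f = Inf])
      (use group.generate_consistent [OF group_rat_group _ H] in auto)
  have empty: "generate rat_group {} = {0}"
    using group.generate_empty [OF group_rat_group] by simp
  show ?thesis
  proof (cases "H = {0}")
    case True
    then have "0 \<in> A"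
      unfolding A_def using empty by (auto intro!: exI [of _ "{}"] simp: zero_enat_def)
    then show ?thesis
      using True rank by (metis Inf_lower le_zero_eq)
  next
    case False
    show ?thesis
    proof (cases "\<exists>c. H = multiples c")
      case True
      then obtain c where c: "H = multiples c" ..
      have "generate rat_group {c} = H"
        by (simp add: c generate_rat_singleton)
      moreover from this have "c \<in> H"
        by (auto intro: generate.incl)
      ultimately have "1 \<in> A"
        unfolding A_def by (auto intro!: exI [of _ "{c}"] simp: one_enat_def)
      then have "Inf A \<le> 1" by (rule Inf_lower)
      moreover have "1 \<le> a" if "a \<in> A" for a
        using that empty \<open>H \<noteq> {0}\<close>
        by (auto simp: A_def one_enat_def Suc_le_eq card_gt_0_iff)
      then have "1 \<le> Inf A" by (rule Inf_greatest)
      ultimately show ?thesis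
        using True False rank by simp
    next
      case noncyclic: False
      \<comment> \<open>Without finite generating sets the infimum is over the empty set, hence
        \<open>\<infinity>\<close>.\<close>
      then have "A = {}"
        unfolding A_def using finitely_generated_imp_cyclic by blast
      then show ?thesis
        using noncyclic False rank by (simp add: Inf_enat_def)
    qed
  qed
qed

section \<open>Denominators relative to a fixed element\<close>

text \<open>For a subgroup \<open>H\<close> and nonzero \<open>x \<in> H\<close>, these are the
  orders of the elements of \<open>H\<close> modulo the multiples of \<open>x\<close>.\<close>

definition denominators :: "rat \<Rightarrow> rat set \<Rightarrow> nat set" where
  "denominators x H = {b. b > 0 \<and> x / of_nat b \<in> H}"

lemma denominators_dvd:
  assumes H: "subgroup H rat_group" and b: "b \<in> denominators x H" and "d dvd b"
  shows "d \<in> denominators x H"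
proof -
  obtain m where m: "b = d * m" using \<open>d dvd b\<close> by blast
  have "of_int (int m) * (x / of_nat b) \<in> H"
    using b by (intro subgroup_of_int_mult [OF H]) (simp add: denominators_def)
  then show ?thesis
    using b m by (simp add: denominators_def)
qed

text \<open>Bezout: if \<open>y / x = a / d\<close> in lowest terms and
  \<open>u * a + v * d = 1\<close>, then \<open>x / d = u * y + v * x\<close>.\<close>

lemma denominator_quotient_mem:
  assumes H: "subgroup H rat_group" and x: "x \<in> H" "x \<noteq> 0" and y: "y \<in> H"
  shows "nat (snd (quotient_of (y / x))) \<in> denominators x H"
proof -
  obtain a d where q: "quotient_of (y / x) = (a, d)" by fastforce
  have z: "y / x = of_int a / of_int d" and d: "d > 0" and cop: "coprime a d"
    using quotient_of_div quotient_of_denom_pos quotient_of_coprime q by blast+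
  obtain u v where "u * a + v * d = 1"
    using cop by (metis bezout_int coprime_iff_gcd_eq_1)
  then have uv: "of_int u * of_int a + of_int v * of_int d = (1 :: rat)"
    by (metis of_int_1 of_int_add of_int_mult)
  have y_eq: "y = x * of_int a / of_int d"
    using z x(2) by (simp add: field_simps)
  have "of_int u * y + of_int v * x = x * (of_int u * of_int a + of_int v * of_int d) / of_int d"
    using d by (simp add: y_eq field_simps)
  also have "\<dots> = x / of_nat (nat d)"
    using d by (simp add: uv)
  finally have "x / of_nat (nat d) = of_int u * y + of_int v * x" ..
  moreover have "of_int u * y + of_int v * x \<in> H"
    using subgroup.m_closed [OF H subgroup_of_int_mult [OF H y] subgroup_of_int_mult [OF H x(1)]]
    by simp
  ultimately show ?thesis
    using d by (simp add: denominators_def q)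
qed

text \<open>If \<open>x = m * c\<close>, every denominator divides \<open>m\<close>, which is
  nonzero. Conversely, the product \<open>N\<close> of finitely many denominators clears that of
  every \<open>y / x\<close>, so multiplication by \<open>N / x\<close> maps \<open>H\<close> into
  the integers.\<close>

lemma cyclic_iff_finite_denominators:
  assumes H: "subgroup H rat_group" and x: "x \<in> H" "x \<noteq> 0"
  shows "(\<exists>c. H = multiples c) \<longleftrightarrow> finite (denominators x H)"
proof
  assume "\<exists>c. H = multiples c"
  then obtain c where c: "H = multiples c" ..
  obtain m where m: "x = of_int m * c"
    using x(1) by (auto simp: c multiples_def)
  have "b dvd nat \<bar>m\<bar>" if "b \<in> denominators x H" for b
  proof -
    have "b > 0" "x / of_nat b \<in> range (\<lambda>n. of_int n * c)"
      using that by (simp_all add: denominators_def c multiples_def)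
    then obtain n where "b > 0" "x / of_nat b = of_int n * c" by blast
    then have "of_int m * c = of_int (n * int b) * c"
      using m by (simp add: field_simps)
    then have "m = n * int b"
      using x(2) m by (simp only: mult_cancel_right of_int_eq_iff) auto
    then show ?thesis by (simp add: abs_mult nat_mult_distrib)
  qed
  moreover have "m \<noteq> 0" using m x(2) by auto
  ultimately show "finite (denominators x H)"
    using finite_divisors_nat [of "nat \<bar>m\<bar>"] by (auto intro: finite_subset [of _ "{d. d dvd nat \<bar>m\<bar>}"])
next
  assume fin: "finite (denominators x H)"
  define N where "N = \<Prod>(denominators x H)"
  have "N \<noteq> 0" using fin by (auto simp: N_def denominators_def)
  have "of_nat N / x * y \<in> \<int>" if y: "y \<in> H" for y
  proof -
    have "nat (snd (quotient_of (y / x))) dvd N"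
      unfolding N_def using dvd_prodI [OF fin denominator_quotient_mem [OF H x y]] by simp
    then have "snd (quotient_of (y / x)) dvd int N"
      using quotient_of_denom_pos' [of "y / x"]
      by (metis int_dvd_int_iff less_imp_le nat_0_le)
    then have "of_int (int N) * (y / x) \<in> \<int>"
      by (simp only: of_int_mult_in_Ints_iff)
    then show ?thesis by simp
  qed
  then show "\<exists>c. H = multiples c"
    using bounded_denominator_imp_cyclic [OF H, of "of_nat N / x"] \<open>N \<noteq> 0\<close> x(2) by auto
qed

text \<open>The set is closed under divisors. If it contains only finitely many primes and omits
  some power of each prime, then all its elements divide one fixed number.\<close>

lemma infinite_denominators_iff:
  assumes H: "subgroup H rat_group"
  shows "infinite (denominators x H) \<longleftrightarrow>
    infinite {p \<in> denominators x H. prime p} \<or> (\<exists>p. prime p \<and> (\<forall>n. p ^ n \<in> denominators x H))"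
proof (intro iffI; (elim disjE exE conjE)?)
  assume inf: "infinite (denominators x H)"
  let ?P = "{p \<in> denominators x H. prime p}"
  show "infinite ?P \<or> (\<exists>p. prime p \<and> (\<forall>n. p ^ n \<in> denominators x H))"
  proof (rule ccontr)
    assume "\<not> ?thesis"
    then have fin: "finite ?P" and "\<forall>p. prime p \<longrightarrow> (\<exists>n. p ^ n \<notin> denominators x H)"
      by auto
    \<comment> \<open>By closure under divisors, omitting \<open>p ^ e p\<close> keeps the
      multiplicity of \<open>p\<close> in any denominator below \<open>e p\<close>.\<close>
    then obtain e where e: "\<And>p. prime p \<Longrightarrow> p ^ e p \<notin> denominators x H"
      by metis
    have "b dvd (\<Prod>p\<in>?P. p ^ e p)" if b: "b \<in> denominators x H" for b
    proof -
      have "b \<noteq> 0" using b by (simp add: denominators_def)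
      have "p ^ multiplicity p b dvd p ^ e p" if "p \<in> prime_factors b" for p
        using e [of p] that denominators_dvd [OF H b] multiplicity_dvd' [of "e p" p b]
        by (meson in_prime_factors_imp_prime le_imp_power_dvd nat_le_linear)
      then have "(\<Prod>p\<in>prime_factors b. p ^ multiplicity p b) dvd (\<Prod>p\<in>prime_factors b. p ^ e p)"
        by (rule prod_dvd_prod)
      also have "\<dots> dvd (\<Prod>p\<in>?P. p ^ e p)"
        using denominators_dvd [OF H b]
        by (intro prod_dvd_prod_subset fin) (auto simp: in_prime_factors_iff)
      finally show ?thesis
        using \<open>b \<noteq> 0\<close> by (metis normalize_nat_def prod_prime_factors id_apply)
    qed
    moreover have "(\<Prod>p\<in>?P. p ^ e p) \<noteq> 0"
      using fin by (auto simp: denominators_def)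
    ultimately have "finite (denominators x H)"
      using finite_divisors_nat [of "\<Prod>p\<in>?P. p ^ e p"]
      by (auto intro: finite_subset [of _ "{d. d dvd (\<Prod>p\<in>?P. p ^ e p)}"])
    with inf show False by contradiction
  qed
next
  assume "infinite {p \<in> denominators x H. prime p}"
  then show "infinite (denominators x H)"
    by (rule contrapos_nn) simp
next
  fix p :: nat
  assume p: "prime p" "\<forall>n. p ^ n \<in> denominators x H"
  then have "range (\<lambda>n. p ^ n) \<subseteq> denominators x H" by auto
  moreover have "inj (\<lambda>n. p ^ n)"
    using prime_gt_1_nat [OF p(1)] by (auto intro!: injI)
  ultimately show "infinite (denominators x H)"
    using infinite_super range_inj_infinite by blast
qed

section \<open>The p-adic description\<close>

text \<open>Frees \<open>padic_val\<close> from lowest terms: equal fractions cross-multiply to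
  \<open>a * d = c * b\<close>, and multiplicities of a prime add up.\<close>

lemma padic_val_divide:
  assumes p: "prime p" and "a \<noteq> 0" "b \<noteq> 0"
  shows "padic_val p (of_int a / of_int b) =
    int (multiplicity (int p) a) - int (multiplicity (int p) b)"
proof -
  obtain c d where q: "quotient_of (of_int a / of_int b) = (c, d)" by fastforce
  have z: "of_int a / of_int b = (of_int c / of_int d :: rat)" and d: "d > 0"
    using quotient_of_div quotient_of_denom_pos q by blast+
  have "of_int (a * d) = (of_int (c * b) :: rat)"
    using z d \<open>b \<noteq> 0\<close> by (simp add: field_simps)
  then have eq: "a * d = c * b" by (simp only: of_int_eq_iff)
  have "prime_elem (int p)" using p by simp
  moreover have "c \<noteq> 0" using eq assms d by auto
  ultimately have "multiplicity (int p) a + multiplicity (int p) d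
      = multiplicity (int p) c + multiplicity (int p) b"
    using arg_cong [OF eq, of "multiplicity (int p)"] assms d
    by (simp add: prime_elem_multiplicity_mult_distrib)
  then show ?thesis by (simp add: padic_val_def q)
qed

lemma padic_val_quotient:
  assumes p: "prime p" and "x \<noteq> 0" "y \<noteq> 0"
  shows "padic_val p (y / x) = padic_val p y - padic_val p x"
proof -
  obtain a b c d where "quotient_of x = (a, b)" "quotient_of y = (c, d)" by fastforce
  then have x: "x = of_int a / of_int b" "b > 0" and y: "y = of_int c / of_int d" "d > 0"
    using quotient_of_div quotient_of_denom_pos by blast+
  have nz: "a \<noteq> 0" "c \<noteq> 0" using x y assms by auto
  have "y / x = of_int (c * b) / of_int (d * a)"
    by (simp add: x y)
  moreover have "prime_elem (int p)" using p by simp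
  ultimately show ?thesis
    using x y nz p padic_val_divide [OF p, of "c * b" "d * a"]
    by (simp add: prime_elem_multiplicity_mult_distrib padic_val_divide)
qed

lemma padic_val_div_power:
  assumes p: "prime p" and "x \<noteq> 0"
  shows "padic_val p (x / of_nat (p ^ n)) = padic_val p x - int n"
proof -
  have "padic_val p (of_int (int (p ^ n)) / of_int 1) = int n"
    using p by (subst padic_val_divide) (auto simp: prime_elem_multiplicity_mult_distrib)
  then show ?thesis
    using assms by (subst padic_val_quotient) auto
qed

text \<open>Forward, \<open>x / p ^ n\<close> is a witness. Backward, \<open>y / x\<close> has
  valuation at most \<open>- n\<close>, so \<open>p ^ n\<close> divides its denominator, which is
  itself in \<open>denominators x H\<close>.\<close>

lemma prime_power_mem_denominators_iff:
  assumes H: "subgroup H rat_group" and x: "x \<in> H" "x \<noteq> 0" and p: "prime p"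
  shows "p ^ n \<in> denominators x H \<longleftrightarrow> (\<exists>y\<in>H - {0}. padic_val p y \<le> padic_val p x - int n)"
proof
  assume mem: "p ^ n \<in> denominators x H"
  show "\<exists>y\<in>H - {0}. padic_val p y \<le> padic_val p x - int n"
  proof
    show "padic_val p (x / of_nat (p ^ n)) \<le> padic_val p x - int n"
      using padic_val_div_power [OF p x(2)] by simp
    show "x / of_nat (p ^ n) \<in> H - {0}"
      using mem x(2) p by (auto simp: denominators_def)
  qed
next
  assume "\<exists>y\<in>H - {0}. padic_val p y \<le> padic_val p x - int n"
  then obtain y where y: "y \<in> H" "y \<noteq> 0" and le: "padic_val p y \<le> padic_val p x - int n"
    by blast
  define d where "d = snd (quotient_of (y / x))"
  have "d > 0" using quotient_of_denom_pos' d_def by simp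
  have "padic_val p (y / x) \<le> - int n"
    using le padic_val_quotient [OF p x(2) y(2)] by simp
  then have "n \<le> multiplicity (int p) d"
    by (simp add: padic_val_def d_def)
  then have "int p ^ n dvd d" by (rule multiplicity_dvd')
  then have "int (p ^ n) dvd int (nat d)" using \<open>d > 0\<close> by simp
  then have "p ^ n dvd nat d" by (simp only: int_dvd_int_iff)
  then show "p ^ n \<in> denominators x H"
    using denominators_dvd [OF H] denominator_quotient_mem [OF H x y(1)] d_def by blast
qed

lemma supp_minus_inf_eq_denominators:
  assumes H: "subgroup H rat_group" and x: "x \<in> H" "x \<noteq> 0"
  shows "supp_minus_inf H = {p. prime p \<and> (\<forall>n. p ^ n \<in> denominators x H)}"
proof -
  have "lgcd p H = -\<infinity> \<longleftrightarrow> (\<forall>n. p ^ n \<in> denominators x H)" if p: "prime p" for p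
  proof
    assume lgcd: "lgcd p H = -\<infinity>"
    show "\<forall>n. p ^ n \<in> denominators x H"
    proof
      fix n
      have "lgcd p H < ereal (real_of_int (padic_val p x - int n))"
        by (simp add: lgcd)
      then obtain y where "y \<in> H - {0}" "real_of_int (padic_val p y) < real_of_int (padic_val p x - int n)"
        unfolding lgcd_def INF_less_iff by auto
      then show "p ^ n \<in> denominators x H"
        unfolding prime_power_mem_denominators_iff [OF H x p] by force
    qed
  next
    assume "\<forall>n. p ^ n \<in> denominators x H"
    then have ex: "\<exists>y\<in>H - {0}. padic_val p y \<le> padic_val p x - int n" for n
      unfolding prime_power_mem_denominators_iff [OF H x p] by blast
    have "lgcd p H \<le> ereal B" for B
    proof -
      obtain n :: nat where n: "real_of_int (padic_val p x) - B \<le> real n"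
        using real_arch_simple by blast
      obtain y where y: "y \<in> H - {0}" "padic_val p y \<le> padic_val p x - int n"
        using ex by blast
      from y(2) have "real_of_int (padic_val p y) \<le> real_of_int (padic_val p x) - real n"
        by linarith
      then have "ereal (real_of_int (padic_val p y)) \<le> ereal B"
        using n by simp
      with y(1) show ?thesis
        unfolding lgcd_def by (rule INF_lower2)
    qed
    then show "lgcd p H = -\<infinity>"
      by (rule ereal_bot)
  qed
  then show ?thesis by (auto simp: supp_minus_inf_def)
qed

text \<open>Outside the finite set \<open>E\<close> the valuation of \<open>x\<close> is 0, so
  \<open>lgcd p H\<close> is at most 0, and it is nonzero iff some valuation is at most -1, that is,
  iff \<open>p\<close> is a denominator. The two sets of primes thus differ by a finite set.\<close>

lemma finite_support_iff_denominators:
  assumes H: "subgroup H rat_group" and x: "x \<in> H" "x \<noteq> 0"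
  shows "finite_support H \<longleftrightarrow> finite {p \<in> denominators x H. prime p}"
proof -
  define E where "E = {p. prime p \<and> padic_val p x \<noteq> 0}"
  obtain a b where q: "quotient_of x = (a, b)" by fastforce
  have ab: "x = of_int a / of_int b" "b > 0"
    using quotient_of_div quotient_of_denom_pos q by blast+
  have "a \<noteq> 0" using ab x by auto
  have "p dvd nat \<bar>a * b\<bar>" if "p \<in> E" for p
  proof -
    have "multiplicity (int p) a \<noteq> 0 \<or> multiplicity (int p) b \<noteq> 0"
      using that by (auto simp: E_def padic_val_def q)
    then have "int p dvd a \<or> int p dvd b"
      by (metis not_dvd_imp_multiplicity_0)
    then have "int p dvd \<bar>a * b\<bar>" by auto
    then show ?thesis by (metis abs_ge_zero int_dvd_int_iff nat_0_le)
  qed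
  moreover have "nat \<bar>a * b\<bar> > 0" using \<open>a \<noteq> 0\<close> ab by simp
  then have "finite {d. d dvd nat \<bar>a * b\<bar>}" by (rule finite_divisors_nat)
  ultimately have finE: "finite E"
    by (auto intro: finite_subset [of E "{d. d dvd nat \<bar>a * b\<bar>}"])
  have "lgcd p H \<noteq> 0 \<longleftrightarrow> p \<in> denominators x H" if p: "prime p" "p \<notin> E" for p
  proof -
    have val: "padic_val p x = 0" using p by (simp add: E_def)
    have "lgcd p H \<le> 0"
      unfolding lgcd_def by (rule INF_lower2 [of x]) (use x val in auto)
    then have "lgcd p H \<noteq> 0 \<longleftrightarrow> lgcd p H < 0" by (simp add: order.strict_iff_order)
    also have "\<dots> \<longleftrightarrow> (\<exists>y\<in>H - {0}. padic_val p y < 0)"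
      unfolding lgcd_def INF_less_iff by (simp add: zero_ereal_def)
    also have "\<dots> \<longleftrightarrow> (\<exists>y\<in>H - {0}. padic_val p y \<le> padic_val p x - int 1)"
      by (intro bex_cong) (use val in auto)
    also have "\<dots> \<longleftrightarrow> p \<in> denominators x H"
      using prime_power_mem_denominators_iff [OF H x p(1), of 1] by simp
    finally show ?thesis .
  qed
  then have "{p. prime p \<and> lgcd p H \<noteq> 0} \<subseteq> {p \<in> denominators x H. prime p} \<union> E"
    and "{p \<in> denominators x H. prime p} \<subseteq> {p. prime p \<and> lgcd p H \<noteq> 0} \<union> E"
    by auto
  then show ?thesis
    unfolding finite_support_def using finE finite_subset finite_UnI by metis
qed

section \<open>Ranks of intersections\<close>

abbreviation rat_rank :: "rat set \<Rightarrow> enat" where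
  "rat_rank H \<equiv> group_rank (rat_group\<lparr>carrier := H\<rparr>)"

lemma subgroup_rat_nontrivial:
  assumes "subgroup H rat_group" "H \<noteq> {0}"
  obtains x where "x \<in> H" "x \<noteq> 0"
  using assms unfolding subgroup_rat_iff by blast

lemma rat_rank_cases:
  assumes "subgroup H rat_group"
  shows "rat_rank H \<in> {0, 1, \<infinity>}"
  by (simp add: group_rank_subgroup_rat [OF assms])

lemma rat_rank_eq_0_iff:
  assumes "subgroup H rat_group"
  shows "rat_rank H = 0 \<longleftrightarrow> H = {0}"
  by (simp add: group_rank_subgroup_rat [OF assms])

lemma rat_rank_eq_infinity_iff:
  assumes H: "subgroup H rat_group" and x: "x \<in> H" "x \<noteq> 0"
  shows "rat_rank H = \<infinity> \<longleftrightarrow> infinite (denominators x H)"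
  using cyclic_iff_finite_denominators [OF assms] x
  by (auto simp: group_rank_subgroup_rat [OF H] one_enat_def zero_enat_def)

lemma rat_rank_eq_1_iff:
  assumes H: "subgroup H rat_group" and x: "x \<in> H" "x \<noteq> 0"
  shows "rat_rank H = 1 \<longleftrightarrow> finite (denominators x H)"
  using rat_rank_eq_infinity_iff [OF assms] rat_rank_cases [OF H] rat_rank_eq_0_iff [OF H] x
  by (auto simp: one_enat_def)

lemma denominators_mono: "J \<subseteq> H \<Longrightarrow> denominators x J \<subseteq> denominators x H"
  by (auto simp: denominators_def)

text \<open>General groups lack this monotonicity. Here a nonzero \<open>x \<in> J\<close> lies in
  \<open>H\<close> too, and finiteness of the denominators relative to this one \<open>x\<close>
  decides both ranks.\<close>

lemma rat_rank_mono:
  assumes J: "subgroup J rat_group" and H: "subgroup H rat_group" and "J \<subseteq> H"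
  shows "rat_rank J \<le> rat_rank H"
proof (cases "J = {0}")
  case True
  then show ?thesis using rat_rank_eq_0_iff [OF J] by simp
next
  case False
  then obtain x where x: "x \<in> J" "x \<noteq> 0"
    using subgroup_rat_nontrivial [OF J] by blast
  then have "x \<in> H" using \<open>J \<subseteq> H\<close> by blast
  show ?thesis
  proof (cases "finite (denominators x H)")
    case True
    then have "finite (denominators x J)"
      using denominators_mono [OF \<open>J \<subseteq> H\<close>] by (rule finite_subset [rotated])
    then show ?thesis
      using True rat_rank_eq_1_iff [OF J x] rat_rank_eq_1_iff [OF H \<open>x \<in> H\<close> x(2)] by simp
  next
    case False
    then show ?thesis
      using rat_rank_eq_infinity_iff [OF H \<open>x \<in> H\<close> x(2)] by simp
  qed
qed

text \<open>Nonzero rationals are commensurable: \<open>y / x = a / d\<close> gives the common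
  nonzero multiple \<open>a * x = d * y\<close>.\<close>

lemma INT_subgroups_nontrivial:
  assumes "finite I" and "\<And>i. i \<in> I \<Longrightarrow> subgroup (H i) rat_group \<and> H i \<noteq> {0}"
  shows "\<exists>x. x \<noteq> 0 \<and> x \<in> (\<Inter>i\<in>I. H i)"
  using assms
proof (induction I rule: finite_induct)
  case empty
  \<comment> \<open>The empty intersection is the whole type, so any nonzero rational will
    do.\<close>
  show ?case by (rule exI [of _ 1]) simp
next
  case (insert j I)
  then obtain x where x: "x \<noteq> 0" "x \<in> (\<Inter>i\<in>I. H i)" by auto
  obtain y where y: "y \<in> H j" "y \<noteq> 0"
    using insert.prems [of j] subgroup_rat_nontrivial by blast
  obtain a d where q: "quotient_of (y / x) = (a, d)" by fastforce
  have z: "y / x = of_int a / of_int d" and d: "d > 0"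
    using quotient_of_div quotient_of_denom_pos q by blast+
  have eq: "of_int a * x = of_int d * y"
    using z x d by (simp add: field_simps)
  have "of_int d * y \<in> H i" if "i \<in> insert j I" for i
  proof (cases "i = j")
    case True
    then show ?thesis
      using insert.prems [of j] y subgroup_of_int_mult by blast
  next
    case False
    then have "of_int a * x \<in> H i"
      using insert.prems [of i] that x(2) subgroup_of_int_mult by blast
    then show ?thesis by (simp add: eq)
  qed
  moreover have "of_int d * y \<noteq> 0" using d y by simp
  ultimately show ?case by blast
qed

text \<open>The infimum in \<open>lgcd\<close> runs over the empty set and is
  \<open>\<infinity>\<close>. Hence a subgroup with nonempty \<open>supp_minus_inf\<close> is
  nontrivial.\<close>

lemma supp_minus_inf_trivial: "supp_minus_inf {0} = {}"
  by (auto simp: supp_minus_inf_def lgcd_def top_ereal_def)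

lemma supp_minus_inf_mono: "H \<subseteq> G \<Longrightarrow> supp_minus_inf H \<subseteq> supp_minus_inf G"
proof -
  assume "H \<subseteq> G"
  then have "lgcd p G \<le> lgcd p H" for p
    unfolding lgcd_def by (intro INF_superset_mono) auto
  then show ?thesis
    unfolding supp_minus_inf_def by (metis (mono_tags, lifting) Collect_mono ereal_infty_less_eq(2))
qed

text \<open>Relative to one nonzero \<open>x\<close> common to all \<open>H i\<close>, the condition
  at \<open>p\<close> says that every \<open>x / p ^ n\<close> is a member, which passes to
  intersections.\<close>

lemma INT_supp_minus_inf_subset:
  assumes "finite I" and H: "\<And>i. i \<in> I \<Longrightarrow> subgroup (H i) rat_group \<and> H i \<noteq> {0}"
    and "I \<noteq> {}"
  shows "(\<Inter>i\<in>I. supp_minus_inf (H i)) \<subseteq> supp_minus_inf (\<Inter>i\<in>I. H i)"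
proof -
  obtain x where x: "x \<noteq> 0" "x \<in> (\<Inter>i\<in>I. H i)"
    using INT_subgroups_nontrivial [of I H] assms(1,2) by blast
  have "subgroup (\<Inter>i\<in>I. H i) rat_group"
    using H by (intro subgroup_INT_rat) blast
  then have INT: "supp_minus_inf (\<Inter>i\<in>I. H i) =
      {p. prime p \<and> (\<forall>n. p ^ n \<in> denominators x (\<Inter>i\<in>I. H i))}"
    using x by (intro supp_minus_inf_eq_denominators)
  have each: "supp_minus_inf (H i) = {p. prime p \<and> (\<forall>n. p ^ n \<in> denominators x (H i))}"
    if "i \<in> I" for i
    using that x H by (intro supp_minus_inf_eq_denominators) auto
  show ?thesis
  proof
    fix p assume "p \<in> (\<Inter>i\<in>I. supp_minus_inf (H i))"
    then have "prime p \<and> (\<forall>n. p ^ n \<in> denominators x (H i))" if "i \<in> I" for i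
      using that each by blast
    then show "p \<in> supp_minus_inf (\<Inter>i\<in>I. H i)"
      using \<open>I \<noteq> {}\<close> unfolding INT denominators_def by blast
  qed
qed

lemma rat_rank_infinity_if_supp:
  assumes H: "subgroup H rat_group" and "supp_minus_inf H \<noteq> {}"
  shows "rat_rank H = \<infinity>"
proof -
  have "H \<noteq> {0}" using assms(2) supp_minus_inf_trivial by auto
  then obtain x where x: "x \<in> H" "x \<noteq> 0"
    using subgroup_rat_nontrivial [OF H] by blast
  then show ?thesis
    using assms(2) unfolding rat_rank_eq_infinity_iff [OF H x] infinite_denominators_iff [OF H]
      supp_minus_inf_eq_denominators [OF H x] by blast
qed

text \<open>The prime denominators of \<open>H\<close> are among the finitely many of
  \<open>G\<close>, so an infinite set of denominators must contain all powers of some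
  prime.\<close>

lemma supp_nonempty_if_rat_rank_infinity:
  assumes G: "subgroup G rat_group" and H: "subgroup H rat_group" "H \<subseteq> G"
    and fin: "finite_support G" and rank: "rat_rank H = \<infinity>"
  shows "supp_minus_inf H \<noteq> {}"
proof -
  have "H \<noteq> {0}" using rank rat_rank_eq_0_iff [OF H(1)] by auto
  then obtain x where x: "x \<in> H" "x \<noteq> 0"
    using subgroup_rat_nontrivial [OF H(1)] by blast
  then have "finite {p \<in> denominators x G. prime p}"
    using fin finite_support_iff_denominators [OF G] H(2) by blast
  then have "finite {p \<in> denominators x H. prime p}"
    by (rule finite_subset [rotated]) (use denominators_mono [OF H(2)] in auto)
  then show ?thesis
    using rank unfolding rat_rank_eq_infinity_iff [OF H(1) x] infinite_denominators_iff [OF H(1)]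
      supp_minus_inf_eq_denominators [OF H(1) x] by blast
qed

section \<open>Subgroups with prescribed denominators\<close>

text \<open>For a subgroup \<open>G\<close> and nonzero \<open>x \<in> G\<close>, this is the
  preimage in \<open>G\<close> of the \<open>P\<close>-primary part of \<open>G\<close> modulo the
  multiples of \<open>x\<close>.\<close>

definition denominator_subgroup :: "rat \<Rightarrow> rat set \<Rightarrow> nat set \<Rightarrow> rat set" where
  "denominator_subgroup x G P =
    {y \<in> G. \<forall>p. prime p \<and> int p dvd snd (quotient_of (y / x)) \<longrightarrow> p \<in> P}"

text \<open>The denominator of \<open>(y - z) / x\<close> divides the product of those of
  \<open>y / x\<close> and \<open>z / x\<close>, so no new primes arise.\<close>

lemma subgroup_denominator_subgroup:
  assumes G: "subgroup G rat_group"
  shows "subgroup (denominator_subgroup x G P) rat_group"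
proof -
  have "y - z \<in> denominator_subgroup x G P"
    if y: "y \<in> denominator_subgroup x G P" and z: "z \<in> denominator_subgroup x G P" for y z
  proof -
    let ?d = "\<lambda>u. snd (quotient_of (u / x))"
    have int: "of_int (?d u) * (u / x) \<in> \<int>" for u
      by (simp only: of_int_mult_in_Ints_iff dvd_refl)
    have "of_int (?d z) * (of_int (?d y) * (y / x)) \<in> \<int>" "of_int (?d y) * (of_int (?d z) * (z / x)) \<in> \<int>"
      by (intro Ints_mult Ints_of_int int)+
    then have "of_int (?d z) * (of_int (?d y) * (y / x)) - of_int (?d y) * (of_int (?d z) * (z / x)) \<in> \<int>"
      by (rule Ints_diff)
    also have "of_int (?d z) * (of_int (?d y) * (y / x)) - of_int (?d y) * (of_int (?d z) * (z / x))
        = of_int (?d y * ?d z) * ((y - z) / x)"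
      by (simp add: diff_divide_distrib right_diff_distrib mult_ac)
    finally have dvd: "?d (y - z) dvd ?d y * ?d z"
      by (simp only: of_int_mult_in_Ints_iff)
    have "int p dvd ?d y \<or> int p dvd ?d z" if "prime p" "int p dvd ?d (y - z)" for p
      using dvd_trans [OF that(2) dvd] that(1) by (simp add: prime_dvd_mult_iff)
    then show ?thesis
      using y z G by (auto simp: denominator_subgroup_def subgroup_rat_iff)
  qed
  moreover have "0 \<in> denominator_subgroup x G P"
    using G by (auto simp: denominator_subgroup_def subgroup_rat_iff)
  ultimately show ?thesis by (simp add: subgroup_rat_iff)
qed

lemma denominator_subgroup_subset: "denominator_subgroup x G P \<subseteq> G"
  by (auto simp: denominator_subgroup_def)

lemma base_mem_denominator_subgroup:
  "x \<in> G \<Longrightarrow> x \<noteq> 0 \<Longrightarrow> x \<in> denominator_subgroup x G P"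
  by (auto simp: denominator_subgroup_def)

lemma INT_denominator_subgroup:
  "I \<noteq> {} \<Longrightarrow>
    (\<Inter>i\<in>I. denominator_subgroup x G (P i)) = denominator_subgroup x G (\<Inter>i\<in>I. P i)"
  by (auto simp: denominator_subgroup_def)

text \<open>Relative to \<open>x\<close>, the element \<open>x / b\<close> is \<open>1 / b\<close>,
  already in lowest terms, so the restriction on primes falls on \<open>b\<close> itself.\<close>

lemma denominators_denominator_subgroup:
  assumes "x \<noteq> 0"
  shows "denominators x (denominator_subgroup x G P) =
    {b \<in> denominators x G. \<forall>p. prime p \<and> p dvd b \<longrightarrow> p \<in> P}"
proof -
  have den: "snd (quotient_of (x / of_nat b / x)) = int b" if "b > 0" for b
  proof -
    have "x / of_nat b / x = Fract 1 (int b)"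
      using assms by (simp add: Fract_of_int_quotient)
    then show ?thesis
      using that by (simp add: quotient_of_Fract normalize_def)
  qed
  have "x / of_nat b \<in> denominator_subgroup x G P \<longleftrightarrow>
      x / of_nat b \<in> G \<and> (\<forall>p. prime p \<and> p dvd b \<longrightarrow> p \<in> P)" if "b > 0" for b
    unfolding denominator_subgroup_def mem_Collect_eq den [OF that] int_dvd_int_iff ..
  then show ?thesis
    unfolding denominators_def by blast
qed

text \<open>Every \<open>b\<close> other than 1 has a prime factor, so 1 is the only denominator
  left.\<close>

lemma rat_rank_denominator_subgroup_empty:
  assumes G: "subgroup G rat_group" and x: "x \<in> G" "x \<noteq> 0"
  shows "rat_rank (denominator_subgroup x G {}) = 1"
proof -
  have "denominators x (denominator_subgroup x G {}) \<subseteq> {1}"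
    using prime_factor_nat by (auto simp: denominators_denominator_subgroup [OF x(2)])
  then show ?thesis
    using finite_subset
      rat_rank_eq_1_iff [OF subgroup_denominator_subgroup base_mem_denominator_subgroup, OF G x x(2)]
    by blast
qed

text \<open>A prime in \<open>P\<close> and its powers have no other prime divisor, so either kind
  of infinite family survives the restriction to \<open>P\<close>.\<close>

lemma rat_rank_denominator_subgroup_infinity:
  assumes G: "subgroup G rat_group" and x: "x \<in> G" "x \<noteq> 0"
    and P: "infinite (P \<inter> {p \<in> denominators x G. prime p}) \<or> P \<inter> supp_minus_inf G \<noteq> {}"
  shows "rat_rank (denominator_subgroup x G P) = \<infinity>"
proof -
  let ?D = "denominators x (denominator_subgroup x G P)"
  have "infinite ?D"
    using P
  proof
    assume "infinite (P \<inter> {p \<in> denominators x G. prime p})"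
    moreover have "P \<inter> {p \<in> denominators x G. prime p} \<subseteq> ?D"
      using primes_dvd_imp_eq by (auto simp: denominators_denominator_subgroup [OF x(2)])
    ultimately show ?thesis by (rule infinite_super [rotated])
  next
    assume "P \<inter> supp_minus_inf G \<noteq> {}"
    then obtain p where p: "p \<in> P" "prime p" "\<And>n. p ^ n \<in> denominators x G"
      by (auto simp: supp_minus_inf_eq_denominators [OF G x])
    have "q \<in> P" if "prime q" "q dvd p ^ n" for q n
      using that p(1,2) prime_dvd_power primes_dvd_imp_eq by blast
    then have "p ^ n \<in> ?D" for n
      using p(3) unfolding denominators_denominator_subgroup [OF x(2)] by blast
    then show ?thesis
      using p(2) infinite_denominators_iff [OF subgroup_denominator_subgroup [OF G]] by blast
  qed
  then show ?thesis
    using rat_rank_eq_infinity_iff [OF subgroup_denominator_subgroup base_mem_denominator_subgroup, OF G x x(2)]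
    by blast
qed

lemma disjoint_family_infinite_rank:
  fixes G :: "rat set" and F :: "'a set"
  assumes G: "subgroup G rat_group" and x: "x \<in> G" "x \<noteq> 0" and "finite F"
    and card: "finite_support G \<longrightarrow> card F \<le> card (supp_minus_inf G)"
  obtains P :: "'a \<Rightarrow> nat set" where "disjoint_family_on P F"
    and "\<And>a Q. a \<in> F \<Longrightarrow> P a \<subseteq> Q \<Longrightarrow> rat_rank (denominator_subgroup x G Q) = \<infinity>"
proof (cases "finite_support G")
  case True
  then have "finite (supp_minus_inf G)"
    unfolding finite_support_def supp_minus_inf_def by (rule finite_subset [rotated]) auto
  \<comment> \<open>The cardinality bound gives an injection, hence disjoint singletons.\<close>
  then obtain f where f: "f ` F \<subseteq> supp_minus_inf G" "inj_on f F"
    using card_le_inj [OF \<open>finite F\<close>] card True by blast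
  show thesis
  proof
    show "disjoint_family_on (\<lambda>a. {f a}) F"
      using f(2) by (auto simp: disjoint_family_on_def inj_on_def)
    show "rat_rank (denominator_subgroup x G Q) = \<infinity>" if "a \<in> F" "{f a} \<subseteq> Q" for a Q
      by (rule rat_rank_denominator_subgroup_infinity [OF G x]) (use that f(1) in blast)
  qed
next
  case False
  define S where "S = {p \<in> denominators x G. prime p}"
  have "infinite S"
    using False finite_support_iff_denominators [OF G x] by (simp add: S_def)
  \<comment> \<open>Infinitely many prime denominators split into disjoint infinite pieces;
    \<open>g\<close> below assigns distinct pieces to distinct elements of \<open>F\<close>.\<close>
  then obtain C :: "nat \<Rightarrow> nat set" where
    C: "pairwise (\<lambda>i j. disjnt (C i) (C j)) UNIV" "(\<Union>i. C i) \<subseteq> S" "\<And>i. infinite (C i)"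
    using infinite_infinite_partition by blast
  obtain g :: "'a \<Rightarrow> nat" where g: "inj_on g F"
    using finite_imp_inj_to_nat_seg [OF \<open>finite F\<close>] by blast
  show thesis
  proof
    show "disjoint_family_on (\<lambda>a. C (g a)) F"
      using C(1) g by (auto simp: disjoint_family_on_def pairwise_def disjnt_def inj_on_def)
    show "rat_rank (denominator_subgroup x G Q) = \<infinity>" if "C (g a) \<subseteq> Q" for a Q
    proof (rule rat_rank_denominator_subgroup_infinity [OF G x])
      have "C (g a) \<subseteq> Q \<inter> S" using that C(2) by blast
      then have "infinite (Q \<inter> S)" using C(3) by (rule infinite_super)
      then show "infinite (Q \<inter> {p \<in> denominators x G. prime p}) \<or> Q \<inter> supp_minus_inf G \<noteq> {}"
        by (simp add: S_def)
    qed
  qed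
qed

section \<open>Rank intersection configurations\<close>

lemma finite_nonempty_subsets: "finite (nonempty_subsets k)"
  by (simp add: nonempty_subsets_def)

lemma realizable_rat_iff:
  assumes G: "subgroup G rat_group"
  shows "realizable k \<chi> (rat_group\<lparr>carrier := G\<rparr>) \<longleftrightarrow>
    (\<exists>H. (\<forall>i\<in>{1..k}. subgroup (H i) rat_group \<and> H i \<subseteq> G) \<and>
      (\<forall>I\<in>nonempty_subsets k. rat_rank (\<Inter>i\<in>I. H i) = \<chi> I))"
  by (simp add: realizable_def subgroup_restrict_iff [OF G])

lemma minimal_subset_below:
  assumes "I \<in> level_set k \<chi> r"
  obtains J where "J \<in> minimal_subsets k \<chi> r" "J \<subseteq> I"
proof -
  have "finite (level_set k \<chi> r)"
    by (simp add: level_set_def finite_nonempty_subsets)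
  from finite_has_minimal2 [OF this assms] show thesis
    using that by (auto simp: minimal_subsets_def)
qed

lemma maximal_subset_above:
  assumes "I \<in> level_set k \<chi> r"
  obtains J where "J \<in> maximal_subsets k \<chi> r" "I \<subseteq> J"
proof -
  have "finite (level_set k \<chi> r)"
    by (simp add: level_set_def finite_nonempty_subsets)
  from finite_has_maximal2 [OF this assms] show thesis
    using that by (auto simp: maximal_subsets_def)
qed

section \<open>Necessity of the conditions\<close>

locale rat_realization =
  fixes G :: "rat set" and k :: nat and \<chi> :: "nat set \<Rightarrow> enat" and H :: "nat \<Rightarrow> rat set"
  assumes G: "subgroup G rat_group"
    and H: "\<And>i. i \<in> {1..k} \<Longrightarrow> subgroup (H i) rat_group"
    and H_sub: "\<And>i. i \<in> {1..k} \<Longrightarrow> H i \<subseteq> G"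
    and rank: "\<And>I. I \<in> nonempty_subsets k \<Longrightarrow> rat_rank (\<Inter>i\<in>I. H i) = \<chi> I"
begin

lemma subgroup_INT: "I \<in> nonempty_subsets k \<Longrightarrow> subgroup (\<Inter>i\<in>I. H i) rat_group"
  using H by (intro subgroup_INT_rat) (auto simp: nonempty_subsets_def)

lemma INT_subset:
  assumes "I \<in> nonempty_subsets k"
  shows "(\<Inter>i\<in>I. H i) \<subseteq> G"
proof -
  obtain i where "i \<in> I" "i \<in> {1..k}"
    using assms unfolding nonempty_subsets_def by blast
  then show ?thesis using H_sub by blast
qed

text \<open>Finitely many nontrivial subgroups meet nontrivially, so some \<open>H i\<close> is
  trivial, and minimality yields \<open>I = {i}\<close>.\<close>

lemma zero_minimal_singleton:
  assumes "I \<in> minimal_subsets k \<chi> 0"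
  shows "is_singleton I"
proof -
  have I: "I \<in> nonempty_subsets k" "\<chi> I = 0"
    and min: "\<And>J. J \<in> nonempty_subsets k \<Longrightarrow> \<chi> J = 0 \<Longrightarrow> J \<subseteq> I \<Longrightarrow> J = I"
    using assms by (auto simp: minimal_subsets_def level_set_def)
  have fin: "finite I" and sub: "I \<subseteq> {1..k}"
    using I(1) finite_subset by (auto simp: nonempty_subsets_def)
  have "(\<Inter>i\<in>I. H i) = {0}"
    using rat_rank_eq_0_iff [OF subgroup_INT] I rank by metis
  then obtain i where i: "i \<in> I" "H i = {0}"
    using INT_subgroups_nontrivial [OF fin, of H] sub H by blast
  have single: "{i} \<in> nonempty_subsets k"
    using i(1) sub by (auto simp: nonempty_subsets_def)
  moreover have "\<chi> {i} = 0"
    using rat_rank_eq_0_iff [OF subgroup_INT, OF single] rank [OF single] i(2) by simp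
  ultimately have "{i} = I" using min i(1) by blast
  then show ?thesis by (metis is_singletonI)
qed

lemma card_infinity_maximal_le:
  assumes fin: "finite_support G"
  shows "card (maximal_subsets k \<chi> \<infinity>) \<le> card (supp_minus_inf G)"
proof -
  let ?N = "maximal_subsets k \<chi> \<infinity>"
  have "\<exists>p. p \<in> supp_minus_inf (\<Inter>i\<in>M. H i)" if "M \<in> ?N" for M
  proof -
    have M: "M \<in> nonempty_subsets k" "\<chi> M = \<infinity>"
      using that by (auto simp: maximal_subsets_def level_set_def)
    then show ?thesis
      using supp_nonempty_if_rat_rank_infinity [OF G subgroup_INT INT_subset fin] M rank by auto
  qed
  then obtain f where f: "\<And>M. M \<in> ?N \<Longrightarrow> f M \<in> supp_minus_inf (\<Inter>i\<in>M. H i)"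
    by metis
  \<comment> \<open>The set \<open>?J\<close> contains \<open>M\<close>, and \<open>f M\<close>
    stays in \<open>supp_minus_inf\<close> of its intersection, so its rank is still
    \<open>\<infinity>\<close> and maximality gives equality.\<close>
  have recover: "M = {i \<in> {1..k}. f M \<in> supp_minus_inf (H i)}" (is "_ = ?J") if "M \<in> ?N" for M
  proof -
    have M: "M \<in> nonempty_subsets k" using that by (auto simp: maximal_subsets_def level_set_def)
    have sub: "M \<subseteq> ?J"
    proof
      fix i assume i: "i \<in> M"
      then have "(\<Inter>i\<in>M. H i) \<subseteq> H i" by blast
      then show "i \<in> ?J"
        using supp_minus_inf_mono f [OF that] i M by (auto simp: nonempty_subsets_def)
    qed
    then have J: "?J \<in> nonempty_subsets k"
      using M by (auto simp: nonempty_subsets_def)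
    have "H i \<noteq> {0}" if "i \<in> ?J" for i
      using that supp_minus_inf_trivial by auto
    then have "(\<Inter>i\<in>?J. supp_minus_inf (H i)) \<subseteq> supp_minus_inf (\<Inter>i\<in>?J. H i)"
      using H J by (intro INT_supp_minus_inf_subset) (auto simp: nonempty_subsets_def)
    then have "supp_minus_inf (\<Inter>i\<in>?J. H i) \<noteq> {}"
      by blast
    then have "\<chi> ?J = \<infinity>"
      using rat_rank_infinity_if_supp [OF subgroup_INT [OF J]] rank [OF J] by simp
    then show "M = ?J"
      using that J sub unfolding maximal_subsets_def level_set_def by blast
  qed
  have "inj_on f ?N"
  proof (rule inj_onI)
    fix M N assume "M \<in> ?N" "N \<in> ?N" and "f M = f N"
    then show "M = N"
      using recover [of M] recover [of N] by presburger
  qed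
  moreover have "f ` ?N \<subseteq> supp_minus_inf G"
  proof
    fix p assume "p \<in> f ` ?N"
    then obtain M where M: "M \<in> ?N" "p = f M" by blast
    then have "(\<Inter>i\<in>M. H i) \<subseteq> G"
      by (intro INT_subset) (simp add: maximal_subsets_def level_set_def)
    then show "p \<in> supp_minus_inf G"
      using supp_minus_inf_mono f M by blast
  qed
  \<comment> \<open>Finiteness matters because \<open>card\<close> is 0 on infinite sets.\<close>
  moreover have "finite (supp_minus_inf G)"
    using fin unfolding finite_support_def supp_minus_inf_def by (rule finite_subset [rotated]) auto
  ultimately show ?thesis by (rule card_inj_on_le)
qed

end

section \<open>Sufficiency of the conditions\<close>

lemma configuration_realizable:
  assumes G: "subgroup G rat_group" and x: "x \<in> G" "x \<noteq> 0"
    and im: "\<chi> ` nonempty_subsets k \<subseteq> {0, 1, \<infinity>}"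
    and dec: "\<And>I J. I \<in> nonempty_subsets k \<Longrightarrow> J \<in> nonempty_subsets k \<Longrightarrow> I \<subseteq> J \<Longrightarrow> \<chi> J \<le> \<chi> I"
    and min: "\<And>I. I \<in> minimal_subsets k \<chi> 0 \<Longrightarrow> is_singleton I"
    and card: "finite_support G \<longrightarrow> card (maximal_subsets k \<chi> \<infinity>) \<le> card (supp_minus_inf G)"
  shows "realizable k \<chi> (rat_group\<lparr>carrier := G\<rparr>)"
proof -
  let ?N = "maximal_subsets k \<chi> \<infinity>"
  have "?N \<subseteq> nonempty_subsets k" by (auto simp: maximal_subsets_def level_set_def)
  then have "finite ?N" using finite_nonempty_subsets finite_subset by blast
  then obtain P where disj: "disjoint_family_on P ?N"
    and P: "\<And>M Q. M \<in> ?N \<Longrightarrow> P M \<subseteq> Q \<Longrightarrow> rat_rank (denominator_subgroup x G Q) = \<infinity>"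
    using disjoint_family_infinite_rank [OF G x _ card] by blast
  \<comment> \<open>Each index receives the primes of every maximal set containing it.\<close>
  define Q where "Q i = (\<Union>M\<in>{M\<in>?N. i \<in> M}. P M)" for i
  define H where "H i = (if \<chi> {i} = 0 then {0} else denominator_subgroup x G (Q i))" for i
  have H: "subgroup (H i) rat_group" for i
    using subgroup_denominator_subgroup [OF G] by (auto simp: H_def subgroup_rat_iff)
  have "H i \<subseteq> G" for i
    using denominator_subgroup_subset G by (auto simp: H_def subgroup_rat_iff)
  moreover have "rat_rank (\<Inter>i\<in>I. H i) = \<chi> I" if I: "I \<in> nonempty_subsets k" for I
  proof (cases "\<chi> I = 0")
    case True
    \<comment> \<open>A 0-minimal subset of \<open>I\<close> is a singleton, so one of the
      intersected subgroups was set to \<open>{0}\<close>.\<close>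
    then obtain J where J: "J \<in> minimal_subsets k \<chi> 0" "J \<subseteq> I"
      using I minimal_subset_below [of I k \<chi> 0] by (auto simp: level_set_def)
    obtain i where "J = {i}"
      using min [OF J(1)] by (rule is_singletonE)
    with J have i: "i \<in> I" "\<chi> {i} = 0"
      by (auto simp: minimal_subsets_def level_set_def)
    have "(\<Inter>i\<in>I. H i) \<subseteq> H i" using i(1) by blast
    then have "(\<Inter>i\<in>I. H i) \<subseteq> {0}" using i(2) by (simp add: H_def)
    moreover have sg: "subgroup (\<Inter>i\<in>I. H i) rat_group" using H by (rule subgroup_INT_rat)
    ultimately have "(\<Inter>i\<in>I. H i) = {0}" by (auto simp: subgroup_rat_iff)
    then show ?thesis using rat_rank_eq_0_iff [OF sg] True by simp
  next
    case False
    \<comment> \<open>As \<open>\<chi>\<close> is decreasing, \<open>\<chi> {i} = 0\<close> would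
      force \<open>\<chi> I = 0\<close>.\<close>
    have "\<chi> {i} \<noteq> 0" if "i \<in> I" for i
      using dec [of "{i}" I] that I False by (auto simp: nonempty_subsets_def)
    then have "(\<Inter>i\<in>I. H i) = (\<Inter>i\<in>I. denominator_subgroup x G (Q i))"
      by (intro INF_cong) (simp_all add: H_def)
    also have "\<dots> = denominator_subgroup x G (\<Inter>i\<in>I. Q i)"
      using I by (intro INT_denominator_subgroup) (auto simp: nonempty_subsets_def)
    finally have eq: "(\<Inter>i\<in>I. H i) = denominator_subgroup x G (\<Inter>i\<in>I. Q i)" .
    show ?thesis
    proof (cases "\<exists>M\<in>?N. I \<subseteq> M")
      case True
      then obtain M where M: "M \<in> ?N" "I \<subseteq> M" by blast
      then have "\<chi> M = \<infinity>" "M \<in> nonempty_subsets k"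
        by (auto simp: maximal_subsets_def level_set_def)
      then have "\<chi> I = \<infinity>" using dec [OF I _ M(2)] by simp
      \<comment> \<open>Every \<open>i \<in> I\<close> lies in \<open>M\<close>, so all of
        \<open>P M\<close> survives the intersection.\<close>
      moreover have "P M \<subseteq> (\<Inter>i\<in>I. Q i)" using M by (auto simp: Q_def)
      ultimately show ?thesis using P M(1) eq by simp
    next
      case none: False
      \<comment> \<open>By disjointness, an element of every \<open>Q i\<close> would come from the
        same \<open>P M\<close> for all \<open>i\<close>, putting \<open>I\<close> inside
        \<open>M\<close>.\<close>
      have "(\<Inter>i\<in>I. Q i) = {}"
      proof (rule ccontr)
        assume "(\<Inter>i\<in>I. Q i) \<noteq> {}"
        then obtain p where "p \<in> (\<Inter>i\<in>I. Q i)" by blast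
        then have p: "\<exists>M\<in>?N. i \<in> M \<and> p \<in> P M" if "i \<in> I" for i
          using that unfolding Q_def by blast
        obtain j where "j \<in> I" using I by (auto simp: nonempty_subsets_def)
        then obtain M where M: "M \<in> ?N" "p \<in> P M" using p by blast
        have "I \<subseteq> M"
        proof
          fix i assume "i \<in> I"
          then obtain M' where "M' \<in> ?N" "i \<in> M'" "p \<in> P M'" using p by blast
          moreover from this have "M' = M"
            using M disj unfolding disjoint_family_on_def by blast
          ultimately show "i \<in> M" by simp
        qed
        with none M show False by blast
      qed
      then have "rat_rank (\<Inter>i\<in>I. H i) = 1"
        using rat_rank_denominator_subgroup_empty [OF G x] eq by simp
      \<comment> \<open>The value \<open>\<infinity>\<close> would place \<open>I\<close> below an
        \<open>\<infinity>\<close>-maximal set.\<close>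
      moreover have "\<chi> I \<noteq> \<infinity>"
        using none maximal_subset_above [of I k \<chi> \<infinity>] I by (auto simp: level_set_def)
      then have "\<chi> I = 1" using im I False by auto
      ultimately show ?thesis by simp
    qed
  qed
  ultimately show ?thesis
    unfolding realizable_rat_iff [OF G] using H by blast
qed

theorem theorem5p12:
  fixes G :: "rat set" and k :: nat and \<chi> :: "nat set \<Rightarrow> enat"
  assumes "subgroup G rat_group" and "G \<noteq> {0}" and "k \<ge> 1"
  shows "realizable k \<chi> (rat_group\<lparr>carrier := G\<rparr>) \<longleftrightarrow>
    \<chi> ` nonempty_subsets k \<subseteq> {0, 1, \<infinity>} \<and>
    (\<forall>I\<in>nonempty_subsets k. \<forall>J\<in>nonempty_subsets k. I \<subseteq> J \<longrightarrow> \<chi> I \<ge> \<chi> J) \<and>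
    (\<forall>I\<in>minimal_subsets k \<chi> 0. is_singleton I) \<and>
    (finite_support G \<longrightarrow>
       card (maximal_subsets k \<chi> \<infinity>) \<le> card (supp_minus_inf G))"
proof
  assume "realizable k \<chi> (rat_group\<lparr>carrier := G\<rparr>)"
  then obtain H where "rat_realization G k \<chi> H"
    unfolding realizable_rat_iff [OF assms(1)] rat_realization_def using assms(1) by blast
  then interpret rat_realization G k \<chi> H .
  have "\<chi> I \<in> {0, 1, \<infinity>}" if "I \<in> nonempty_subsets k" for I
    using rat_rank_cases [OF subgroup_INT [OF that]] rank [OF that] by simp
  moreover have "\<chi> J \<le> \<chi> I"
    if "I \<in> nonempty_subsets k" "J \<in> nonempty_subsets k" "I \<subseteq> J" for I J
  proof -
    have "(\<Inter>i\<in>J. H i) \<subseteq> (\<Inter>i\<in>I. H i)" using that(3) by blast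
    then show ?thesis
      using rat_rank_mono [OF subgroup_INT [OF that(2)] subgroup_INT [OF that(1)]] rank that(1,2)
      by simp
  qed
  ultimately show "\<chi> ` nonempty_subsets k \<subseteq> {0, 1, \<infinity>} \<and>
    (\<forall>I\<in>nonempty_subsets k. \<forall>J\<in>nonempty_subsets k. I \<subseteq> J \<longrightarrow> \<chi> I \<ge> \<chi> J) \<and>
    (\<forall>I\<in>minimal_subsets k \<chi> 0. is_singleton I) \<and>
    (finite_support G \<longrightarrow>
       card (maximal_subsets k \<chi> \<infinity>) \<le> card (supp_minus_inf G))"
    using zero_minimal_singleton card_infinity_maximal_le by (simp add: image_subset_iff)
next
  obtain x where "x \<in> G" "x \<noteq> 0"
    using subgroup_rat_nontrivial [OF assms(1,2)] .
  moreover assume "\<chi> ` nonempty_subsets k \<subseteq> {0, 1, \<infinity>} \<and>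
    (\<forall>I\<in>nonempty_subsets k. \<forall>J\<in>nonempty_subsets k. I \<subseteq> J \<longrightarrow> \<chi> I \<ge> \<chi> J) \<and>
    (\<forall>I\<in>minimal_subsets k \<chi> 0. is_singleton I) \<and>
    (finite_support G \<longrightarrow>
       card (maximal_subsets k \<chi> \<infinity>) \<le> card (supp_minus_inf G))"
  ultimately show "realizable k \<chi> (rat_group\<lparr>carrier := G\<rparr>)"
    using configuration_realizable [OF assms(1)] by simp
qed

end
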